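(* There is a universal constant $C>0$ such that the following holds. Let $n,k,d$ be positive integers with $n\ge 3k$ and suppose $\mathsf{m}^{rd}(d,S_{n,k})>0$. Then $$d\ \ge\ C\,\frac{k\log(n/k)}{\log\bigl(1+2(\mathsf{m}^{rd}(d,S_{n,k})\sqrt{k})^{-1}\bigr)}.$$
   Context: $S_{n,k}\in\{0,1\}^{\binom{n}{k}\times n}$ is the matrix whose rows are all the distinct vectors in $\{0,1\}^n$ with exactly $k$ ones, each appearing exactly once. For $A\in\{0,1\}^{N\times n}$ and $m\ge 0$, unit vectors $U_1,\dots,U_N,V_1,\dots,V_n\in\mathbb{R}^d$ form a margin-$m$, relative-bias-$0$ embedding of $A$ in dimension $d$ if $\langle U_j,V_i\rangle\ge m$ whenever $A_{ji}=1$ and $\langle U_j,V_i\rangle\le -m$ whenever $A_{ji}=0$. $\mathsf{m}^{rd}(d,A)$ is the supremum of $m\ge0$ for which such an embedding exists in dimension $d$ ($-\infty$ if none exists). *)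

theory Defs
  imports "HOL-Analysis.Analysis" "HOL-Library.Extended_Real"
begin

text \<open>Vectors in R^d are represented as functions nat => real vanishing outside {..<d}.\<close>

definition inner_d :: "nat \<Rightarrow> (nat \<Rightarrow> real) \<Rightarrow> (nat \<Rightarrow> real) \<Rightarrow> real" where
  "inner_d d u v = (\<Sum>i<d. u i * v i)"

definition unit_vec :: "nat \<Rightarrow> (nat \<Rightarrow> real) \<Rightarrow> bool" where
  "unit_vec d u \<longleftrightarrow> (\<forall>i\<ge>d. u i = 0) \<and> inner_d d u u = 1"

text \<open>A 0/1 matrix with row index set R (finite) and columns {..<n}, entry A r i.
  Margin-m, relative-bias-0 embedding in dimension d.\<close>

definition rd_embedding :: "nat \<Rightarrow> 'r set \<Rightarrow> nat \<Rightarrow> ('r \<Rightarrow> nat \<Rightarrow> bool) \<Rightarrow> real \<Rightarrow> bool" where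
  "rd_embedding d R n A m \<longleftrightarrow>
     (\<exists>U V. (\<forall>r\<in>R. unit_vec d (U r)) \<and> (\<forall>i<n. unit_vec d (V i)) \<and>
       (\<forall>r\<in>R. \<forall>i<n. (A r i \<longrightarrow> inner_d d (U r) (V i) \<ge> m) \<and>
                     (\<not> A r i \<longrightarrow> inner_d d (U r) (V i) \<le> - m)))"

definition m_rd :: "nat \<Rightarrow> 'r set \<Rightarrow> nat \<Rightarrow> ('r \<Rightarrow> nat \<Rightarrow> bool) \<Rightarrow> ereal" where
  "m_rd d R n A =
     (if {m. m \<ge> 0 \<and> rd_embedding d R n A m} = {} then -\<infinity>
      else Sup (ereal ` {m. m \<ge> 0 \<and> rd_embedding d R n A m}))"

definition S_rows :: "nat \<Rightarrow> nat \<Rightarrow> nat set set" where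
  "S_rows n k = {T. T \<subseteq> {..<n} \<and> card T = k}"

definition S_entry :: "nat set \<Rightarrow> nat \<Rightarrow> bool" where
  "S_entry T i \<longleftrightarrow> i \<in> T"

end

theory Submission
  imports Defs
begin

text \<open>Put \<open>q = n div k\<close> and cut \<open>kq\<close> of the columns into \<open>k\<close> blocks of size \<open>q\<close>. A word
  \<open>f \<in> {..<q}\<^sup>k\<close> selects one column from each block, and \<open>X f\<close> denotes the sum of the
  selected vectors \<open>V\<close>. Testing \<open>X f - X g\<close> against \<open>U\<close> shows that its norm is at least \<open>2m\<close>
  times the Hamming distance of \<open>f\<close> and \<open>g\<close>. The summands of a uniformly random word are
  independent, so the variance of \<open>X\<close> is at most \<open>k\<close> and at least three quarters of all words
  satisfy \<open>norm (X f - E X) \<le> 2 sqrt k\<close>; this is the source of the factor \<open>sqrt k\<close>. Cover this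
  ball by \<open>O(1 + 1 / (m sqrt k))\<^sup>d\<close> cells of diameter \<open>mk/6\<close>. The words falling into one cell
  lie in a Hamming ball of radius \<open>k/12\<close>, which contains a fraction at most
  \<open>O(q\<^sup>-\<^sup>k\<^sup>/\<^sup>4)\<close> of all words. Counting words gives the bound, up to an additive \<open>O(d)\<close>, which is
  absorbed because \<open>m sqrt k \<le> 24\<close>.\<close>

section \<open>Exponential-moment counting: Hamming balls and lattice points\<close>

text \<open>An exponential Markov bound, giving the size of Hamming balls as well as the number of lattice
  points in an \<open>l\<^sub>1\<close>-ball.\<close>

lemma card_mult_exp_le_prod_sum:
  fixes c :: "'a \<Rightarrow> 'b \<Rightarrow> real"
  assumes "finite I" "\<And>i. i \<in> I \<Longrightarrow> finite (B i)" "0 \<le> t"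
    and A: "A \<subseteq> PiE I B" "\<And>f. f \<in> A \<Longrightarrow> (\<Sum>i\<in>I. c i (f i)) \<le> L"
  shows "real (card A) * exp (- t * L) \<le> (\<Prod>i\<in>I. \<Sum>b\<in>B i. exp (- t * c i b))"
proof -
  have fin: "finite (PiE I B)"
    using assms by (intro finite_PiE) auto
  have "real (card A) * exp (- t * L) = (\<Sum>f\<in>A. exp (- t * L))"
    by simp
  also have "\<dots> \<le> (\<Sum>f\<in>A. exp (- t * (\<Sum>i\<in>I. c i (f i))))"
    using A assms(3) by (intro sum_mono) (simp add: mult_left_mono)
  also have "\<dots> \<le> (\<Sum>f\<in>PiE I B. exp (- t * (\<Sum>i\<in>I. c i (f i))))"
    using A fin by (intro sum_mono2) auto
  also have "\<dots> = (\<Sum>f\<in>PiE I B. \<Prod>i\<in>I. exp (- t * c i (f i)))"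
    using assms(1) by (simp add: sum_distrib_left flip: exp_sum sum_negf)
  also have "\<dots> = (\<Prod>i\<in>I. \<Sum>b\<in>B i. exp (- t * c i b))"
    using assms by (subst prod_sum_PiE) auto
  finally show ?thesis .
qed

definition hamming :: "nat \<Rightarrow> (nat \<Rightarrow> 'a) \<Rightarrow> (nat \<Rightarrow> 'a) \<Rightarrow> nat" where
  "hamming k f g = card {j. j < k \<and> f j \<noteq> g j}"

text \<open>Each disagreement with \<open>g\<close> costs 1. At
  \<open>exp (- t) = 1 / (4 * q)\<close> the letters of one coordinate have total weight at most
  \<open>1 + q * exp (- t) = 5/4\<close>, and undoing the Markov factor costs
  \<open>exp (t * h) = (4 * q) powr h\<close>.\<close>

lemma card_hamming_ball_le:
  fixes h :: real
  assumes "0 < q" and A: "A \<subseteq> PiE {..<k} (\<lambda>_. {..<q})" and g: "g \<in> PiE {..<k} (\<lambda>_. {..<q})"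
    and h: "\<And>f. f \<in> A \<Longrightarrow> real (hamming k f g) \<le> h"
  shows "real (card A) \<le> (5/4) ^ k * (4 * real q) powr h"
proof -
  define t where "t = ln (4 * real q)"
  have t: "0 \<le> t" "exp (- t) = 1 / (4 * real q)"
    using assms(1) by (auto simp: t_def exp_minus inverse_eq_divide)
  have "real (card A) * exp (- t * h) \<le>
      (\<Prod>j<k. \<Sum>b<q. exp (- t * of_bool (b \<noteq> g j)))"
  proof (rule card_mult_exp_le_prod_sum)
    fix f assume "f \<in> A"
    have "(\<Sum>j<k. of_bool (f j \<noteq> g j)) = real (hamming k f g)"
      by (simp add: hamming_def of_bool_def sum.If_cases Int_def)
    with h[OF \<open>f \<in> A\<close>] show "(\<Sum>j<k. of_bool (f j \<noteq> g j)) \<le> h"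
      by simp
  qed (use A t in auto)
  also have "\<dots> \<le> (\<Prod>j<k. 5/4)"
  proof (intro prod_mono conjI sum_nonneg)
    fix j assume j: "j \<in> {..<k}"
    have "(\<Sum>b<q. exp (- t * of_bool (b \<noteq> g j))) \<le> (\<Sum>b<q. of_bool (b = g j) + exp (- t))"
      by (intro sum_mono) auto
    also have "\<dots> = 1 + q * exp (- t)"
      using g j by (auto simp: sum.distrib of_bool_def PiE_iff)
    also have "\<dots> = 5/4"
      using assms(1) t by simp
    finally show "(\<Sum>b<q. exp (- t * of_bool (b \<noteq> g j))) \<le> 5/4" .
  qed auto
  finally have "real (card A) * exp (- t * h) \<le> (5/4) ^ k"
    by simp
  then show ?thesis
    using assms(1) by (simp add: powr_def t_def exp_minus field_simps)
qed

lemma sum_power_abs_symmetric_interval: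
  fixes x :: real
  assumes "x \<noteq> 1"
  shows "(\<Sum>z\<in>{- int K..int K}. x ^ nat \<bar>z\<bar>) = (1 + x - 2 * x ^ Suc K) / (1 - x)"
proof (induction K)
  case 0
  then show ?case using assms by simp
next
  case (Suc K)
  have "{- int (Suc K)..int (Suc K)} =
      insert (- int (Suc K)) (insert (int (Suc K)) {- int K..int K})"
    by auto
  then have "(\<Sum>z\<in>{- int (Suc K)..int (Suc K)}. x ^ nat \<bar>z\<bar>) =
      2 * x ^ Suc K + (\<Sum>z\<in>{- int K..int K}. x ^ nat \<bar>z\<bar>)"
    by (simp add: nat_add_distrib)
  also have "\<dots> = (1 + x - 2 * x ^ Suc (Suc K)) / (1 - x)"
    unfolding Suc.IH using assms by (simp add: field_simps)
  finally show ?case .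
qed

text \<open>With weight \<open>x ^ \<bar>b\<bar>\<close> the full two-sided geometric series is
  \<open>(1 + x) / (1 - x)\<close>. The choice \<open>x = \<rho> / (\<rho> + 1)\<close> makes it
  \<open>2 * \<rho> + 1\<close> and keeps \<open>t * \<rho> \<le> 1\<close>, so the Markov factor is
  at most \<open>exp 1 \<le> 3\<close> per coordinate.\<close>

lemma card_int_points_l1_le:
  fixes A :: "(nat \<Rightarrow> int) set" and \<rho> :: real
  assumes \<rho>: "0 < \<rho>" and A: "A \<subseteq> PiE {..<d} (\<lambda>_. UNIV)"
    and l1: "\<And>z. z \<in> A \<Longrightarrow> (\<Sum>i<d. real_of_int \<bar>z i\<bar>) \<le> d * \<rho>"
  shows "real (card A) \<le> (3 * (2 * \<rho> + 1)) ^ d"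
proof -
  define x where "x = \<rho> / (\<rho> + 1)"
  define t where "t = - ln x"
  \<comment> \<open>\<open>K\<close> only truncates the coordinates to a finite range, as the
    counting bound needs finite factors; no point of \<open>A\<close> is lost.\<close>
  define K where "K = nat \<lfloor>d * \<rho>\<rfloor>"
  have x: "0 < x" "x < 1"
    using \<rho> by (auto simp: x_def)
  have t: "0 \<le> t" "exp (- t) = x"
    using x by (auto simp: t_def)
  have "t = ln (1 + 1 / \<rho>)"
    using \<rho> by (simp add: t_def x_def ln_div field_simps)
  then have "t \<le> 1 / \<rho>"
    using ln_add_one_self_le_self[of "1 / \<rho>"] \<rho> by simp
  then have t\<rho>: "t * \<rho> \<le> 1"
    using \<rho> by (simp add: field_simps)
  have geom: "(\<Sum>b\<in>{- int K..int K}. exp (- t * real_of_int \<bar>b\<bar>)) \<le> 2 * \<rho> + 1"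
  proof -
    have "exp (- t * real_of_int \<bar>b\<bar>) = x ^ nat \<bar>b\<bar>" for b
    proof -
      have "exp (- t * real_of_int \<bar>b\<bar>) = exp (real (nat \<bar>b\<bar>) * (- t))"
        by simp
      then show ?thesis
        unfolding exp_of_nat_mult t(2) .
    qed
    then have "(\<Sum>b\<in>{- int K..int K}. exp (- t * real_of_int \<bar>b\<bar>)) =
        (1 + x - 2 * x ^ Suc K) / (1 - x)"
      using sum_power_abs_symmetric_interval[of x K] x by simp
    also have "\<dots> \<le> (1 + x) / (1 - x)"
      using x by (intro divide_right_mono) auto
    also have "\<dots> = 2 * \<rho> + 1"
      using \<rho> by (simp add: x_def field_simps)
    finally show ?thesis .
  qed
  have "real (card A) * exp (- t * (d * \<rho>)) \<le>
      (\<Prod>i<d. \<Sum>b\<in>{- int K..int K}. exp (- t * real_of_int \<bar>b\<bar>))"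
  proof (rule card_mult_exp_le_prod_sum)
    show "A \<subseteq> PiE {..<d} (\<lambda>_. {- int K..int K})"
    proof
      fix z assume z: "z \<in> A"
      have "\<bar>z i\<bar> \<le> int K" if "i < d" for i
      proof -
        have "real_of_int \<bar>z i\<bar> \<le> (\<Sum>i<d. real_of_int \<bar>z i\<bar>)"
          using that by (intro member_le_sum) auto
        then have "real_of_int \<bar>z i\<bar> \<le> d * \<rho>"
          using l1[OF z] by linarith
        then show ?thesis
          unfolding K_def using \<rho> by (simp add: le_floor_iff)
      qed
      then show "z \<in> PiE {..<d} (\<lambda>_. {- int K..int K})"
        using A z by (force simp: PiE_iff abs_le_iff)
    qed
  qed (use l1 t in auto)
  also have "\<dots> \<le> (\<Prod>i<d. 2 * \<rho> + 1)"
    using geom by (intro prod_mono conjI sum_nonneg) auto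
  finally have "real (card A) \<le> (2 * \<rho> + 1) ^ d * exp (d * (t * \<rho>))"
    by (simp add: exp_minus field_simps)
  also have "exp (d * (t * \<rho>)) = exp (t * \<rho>) ^ d"
    by (rule exp_of_nat_mult)
  also have "\<dots> \<le> 3 ^ d"
  proof (rule power_mono)
    have "exp (t * \<rho>) \<le> exp 1" using t\<rho> by simp
    also note exp_le
    finally show "exp (t * \<rho>) \<le> 3" .
  qed simp
  finally show ?thesis
    using \<rho> unfolding power_mult_distrib by (simp add: mult.commute)
qed

section \<open>Second moments of sums over product spaces\<close>

text \<open>Additivity of variance for independent centred variables under the uniform measure. The
  extra factor \<open>card B\<close> on the left avoids division and the exponent
  \<open>card I - 1\<close>.\<close>

lemma sum_PiE_square_sum:
  fixes y :: "'a \<Rightarrow> 'b \<Rightarrow> real"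
  assumes "finite I" "finite B" and zero: "\<And>j. j \<in> I \<Longrightarrow> (\<Sum>b\<in>B. y j b) = 0"
  shows "card B * (\<Sum>f\<in>PiE I (\<lambda>_. B). (\<Sum>j\<in>I. y j (f j))\<^sup>2) =
      real (card B) ^ card I * (\<Sum>j\<in>I. \<Sum>b\<in>B. (y j b)\<^sup>2)"
  using assms(1) zero
proof (induction I rule: finite_induct)
  case empty
  then show ?case by simp
next
  case (insert x I)
  let ?P = "PiE I (\<lambda>_. B)"
  let ?S = "\<lambda>g. \<Sum>j\<in>I. y j (g j)"
  have S: "(\<Sum>j\<in>I. y j ((g(x := b)) j)) = ?S g" for g b
    using insert.hyps by (intro sum.cong) auto
  have "(\<Sum>f\<in>PiE (insert x I) (\<lambda>_. B). (\<Sum>j\<in>insert x I. y j (f j))\<^sup>2) =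
      (\<Sum>(b, g)\<in>B \<times> ?P. (y x b + ?S g)\<^sup>2)"
    unfolding PiE_insert_eq using insert.hyps
    by (subst sum.reindex[OF inj_combinator]) (auto simp: S fun_upd_same simp del: fun_upd_apply intro!: sum.cong)
  \<comment> \<open>The cross term is kept as a product, so that its double sum factors and vanishes
    by centring.\<close>
  also have "\<dots> = (\<Sum>b\<in>B. \<Sum>g\<in>?P. (y x b)\<^sup>2 + (?S g)\<^sup>2 + y x b * (2 * ?S g))"
    by (simp add: sum.cartesian_product power2_sum mult_ac)
  also have "\<dots> = card ?P * (\<Sum>b\<in>B. (y x b)\<^sup>2) + card B * (\<Sum>g\<in>?P. (?S g)\<^sup>2) +
      (\<Sum>b\<in>B. y x b) * (\<Sum>g\<in>?P. 2 * ?S g)"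
    by (simp add: sum.distrib flip: sum_distrib_left sum_distrib_right)
  also have "card ?P = card B ^ card I"
    using insert.hyps by (simp add: card_PiE)
  also have "(\<Sum>b\<in>B. y x b) = 0"
    using insert.prems by simp
  finally show ?case
    using insert by (simp add: algebra_simps)
qed

lemma card_le_four_times_mean_ge:
  fixes g :: "'a \<Rightarrow> real" and c :: real
  assumes "finite P" "\<And>f. f \<in> P \<Longrightarrow> 0 \<le> g f" "(\<Sum>f\<in>P. g f) \<le> card P * c" "0 < c"
  shows "3/4 * real (card P) \<le> card {f\<in>P. g f \<le> 4 * c}"
proof -
  let ?B = "{f\<in>P. \<not> g f \<le> 4 * c}"
  have "card ?B * (4 * c) \<le> (\<Sum>f\<in>?B. g f)"
    by (rule sum_bounded_below) auto
  also have "\<dots> \<le> (\<Sum>f\<in>P. g f)"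
    using assms by (intro sum_mono2) auto
  finally have "(4 * real (card ?B)) * c \<le> real (card P) * c"
    using assms(3) by linarith
  then have "4 * real (card ?B) \<le> card P"
    using assms(4) by (simp only: mult_le_cancel_right_pos)
  moreover have "card P = card {f\<in>P. g f \<le> 4 * c} + card ?B"
    using assms(1) by (subst card_Un_disjoint[symmetric]) (auto intro!: arg_cong[of _ _ card])
  ultimately show ?thesis by linarith
qed

section \<open>Small Hamming balls against the whole word space\<close>

text \<open>A comparison per coordinate, raised to the power \<open>k\<close>:
  \<open>4 * q \<le> q powr 3\<close> turns \<open>(4 * q) powr (1/12)\<close> into at most
  \<open>q powr (1/4)\<close>, and the resulting \<open>5/4 * sqrt q\<close> is at most
  \<open>3/4 * q\<close> because \<open>q \<ge> 3\<close> gives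
  \<open>sqrt q \<ge> 5/3\<close>.\<close>

lemma powr_mult_hamming_ball_bound_le:
  fixes q :: real and k :: nat
  assumes "3 \<le> q" "0 < k"
  shows "q powr (k / 4) * ((5/4) ^ k * (4 * q) powr (k / 12)) \<le> 3/4 * q ^ k"
proof -
  have *: "q powr (1/4) * (5/4 * (4 * q) powr (1/12)) \<le> 3/4 * q"
  proof -
    have "4 * q \<le> q powr 3"
    proof -
      have "4 * q \<le> (3 * 3) * q" using assms by simp
      also have "\<dots> \<le> (q * q) * q" using assms by (intro mult_right_mono mult_mono) auto
      finally show ?thesis using assms by (simp add: power3_eq_cube powr_numeral)
    qed
    then have "(4 * q) powr (1/12) \<le> (q powr 3) powr (1/12)"
      using assms by (intro powr_mono2) auto
    also have "\<dots> = q powr (1/4)"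
      by (subst powr_powr) simp
    finally have "q powr (1/4) * (5/4 * (4 * q) powr (1/12)) \<le>
        q powr (1/4) * (5/4 * q powr (1/4))"
      by (intro mult_left_mono) auto
    also have "\<dots> = 5/4 * sqrt q"
      using assms by (simp add: powr_half_sqrt flip: powr_add)
    also have "\<dots> \<le> 3/4 * (sqrt q * sqrt q)"
    proof -
      have "5/3 \<le> sqrt q"
        using assms by (intro real_le_rsqrt) (simp add: power2_eq_square)
      then have "5/3 * sqrt q \<le> sqrt q * sqrt q"
        using assms by (intro mult_right_mono) auto
      then show ?thesis by simp
    qed
    finally show ?thesis using assms by simp
  qed
  have "q powr (k / 4) * ((5/4) ^ k * (4 * q) powr (k / 12)) =
      (q powr (1/4) * (5/4 * (4 * q) powr (1/12))) ^ k"
    using assms by (simp add: power_mult_distrib power_divide powr_power mult_ac)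
  also have "\<dots> \<le> (3/4 * q) ^ k"
    using * assms by (intro power_mono) auto
  also have "\<dots> \<le> 3/4 * q ^ k"
    unfolding power_mult_distrib using assms power_decreasing[of 1 k "3/4::real"]
    by (intro mult_right_mono) auto
  finally show ?thesis .
qed

section \<open>Covering a ball by small cubes\<close>

text \<open>Points are sorted into cubes of side \<open>r / sqrt d\<close>. Only cubes meeting the ball of
  radius \<open>R\<close> occur, and by Cauchy--Schwarz their integer labels have \<open>l\<^sub>1\<close>-norm at most
  \<open>d * (R / r + 1)\<close>.\<close>

lemma obtains_large_subset_of_diameter_le:
  fixes X :: "'a \<Rightarrow> nat \<Rightarrow> real"
  assumes W: "finite W" and pos: "0 < d" "0 \<le> R" "0 < r"
    and R: "\<And>w. w \<in> W \<Longrightarrow> L2_set (X w) {..<d} \<le> R"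
  obtains A where "A \<subseteq> W" "\<And>u v. u \<in> A \<Longrightarrow> v \<in> A \<Longrightarrow> L2_set (\<lambda>i. X u i - X v i) {..<d} \<le> r"
    "real (card W) \<le> (3 * (2 * (R / r + 1) + 1)) ^ d * card A"
proof (cases "W = {}")
  case True
  then show ?thesis using that[of "{}"] by simp
next
  case False
  define s where "s = r / sqrt d"
  have s: "0 < s" "s * sqrt d = r"
    using pos by (auto simp: s_def)
  define F where "F w = restrict (\<lambda>i. \<lfloor>X w i / s\<rfloor>) {..<d}" for w
  define N where "N z = card {w\<in>W. F w = z}" for z
  have fibre: "L2_set (\<lambda>i. X u i - X v i) {..<d} \<le> r" if uv: "F u = F v" for u v
  proof -
    have "(X u i - X v i)\<^sup>2 \<le> s\<^sup>2" if "i < d" for i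
    proof -
      from uv have "F u i = F v i" by (rule fun_cong)
      then have "\<lfloor>X u i / s\<rfloor> = \<lfloor>X v i / s\<rfloor>"
        using that by (simp add: F_def)
      then have "\<bar>X u i / s - X v i / s\<bar> \<le> 1"
        by linarith
      then have "\<bar>X u i - X v i\<bar> \<le> s"
        using s by (simp add: field_simps flip: diff_divide_distrib)
      then show ?thesis
        by (simp add: abs_le_square_iff[symmetric] s(1) less_imp_le)
    qed
    then have "(\<Sum>i<d. (X u i - X v i)\<^sup>2) \<le> (\<Sum>i<d. s\<^sup>2)"
      by (intro sum_mono) auto
    then have "L2_set (\<lambda>i. X u i - X v i) {..<d} \<le> sqrt (d * s\<^sup>2)"
      by (simp add: L2_set_def)
    also have "\<dots> = r"
      using s by (simp add: real_sqrt_mult mult.commute)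
    finally show ?thesis .
  qed
  have cells: "real (card (F ` W)) \<le> (3 * (2 * (R / r + 1) + 1)) ^ d"
  proof (rule card_int_points_l1_le)
    show "0 < R / r + 1"
      using pos by (simp add: add_nonneg_pos)
    show "F ` W \<subseteq> PiE {..<d} (\<lambda>_. UNIV)"
      by (auto simp: F_def split: if_splits)
    fix z assume "z \<in> F ` W"
    then obtain w where w: "w \<in> W" "z = F w" by auto
    \<comment> \<open>Rounding down moves each label by at most 1; this is the \<open>+ 1\<close> in
      \<open>R / r + 1\<close>.\<close>
    have "(\<Sum>i<d. real_of_int \<bar>z i\<bar>) \<le> (\<Sum>i<d. \<bar>X w i\<bar> / s + 1)"
    proof (rule sum_mono)
      fix i assume "i \<in> {..<d}"
      then have "z i = \<lfloor>X w i / s\<rfloor>" by (simp add: w F_def)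
      moreover have "\<bar>X w i / s\<bar> = \<bar>X w i\<bar> / s"
        using s by simp
      ultimately show "real_of_int \<bar>z i\<bar> \<le> \<bar>X w i\<bar> / s + 1"
        by linarith
    qed
    also have "\<dots> = (\<Sum>i<d. \<bar>X w i\<bar> * \<bar>1\<bar>) / s + d"
      by (simp add: sum.distrib sum_divide_distrib)
    also have "\<dots> \<le> (L2_set (X w) {..<d} * L2_set (\<lambda>_. 1) {..<d}) / s + d"
      using s by (intro add_right_mono divide_right_mono L2_set_mult_ineq) auto
    also have "\<dots> \<le> (R * sqrt d) / s + d"
      using s R[OF w(1)] by (auto simp: L2_set_def intro!: divide_right_mono mult_right_mono)
    also have "\<dots> = d * (R / r + 1)"
      using pos by (simp add: s_def field_simps)
    finally show "(\<Sum>i<d. real_of_int \<bar>z i\<bar>) \<le> d * (R / r + 1)" .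
  qed
  \<comment> \<open>Pigeonhole: a most populated cell serves as \<open>A\<close>.\<close>
  have "Max (N ` F ` W) \<in> N ` F ` W"
    using W False by (intro Max_in) auto
  then obtain z where z: "N z = Max (N ` F ` W)"
    by auto
  have "real (card W) = (\<Sum>z\<in>F ` W. real (N z))"
    using sum.image_gen[OF W, of "\<lambda>_. 1::real" F] by (simp add: N_def)
  also have "\<dots> \<le> real (card (F ` W)) * N z"
    using W by (intro sum_bounded_above) (simp add: z)
  also have "\<dots> \<le> (3 * (2 * (R / r + 1) + 1)) ^ d * N z"
    using cells by (rule mult_right_mono) simp
  finally show ?thesis
    using that[of "{w\<in>W. F w = z}"] fibre by (auto simp: N_def)
qed

section \<open>Concentration of random word sums\<close>

text \<open>The centre is the mean, the sum of the block means \<open>\<mu> j\<close>. Variance is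
  additive in each of the \<open>d\<close> coordinates, and each block has variance at most its mean
  squared norm 1. The average squared distance is thus at most \<open>k\<close>, and Markov's
  inequality applies at \<open>4 * k\<close>.\<close>

lemma obtains_center_of_word_sums:
  fixes v :: "nat \<Rightarrow> nat \<Rightarrow> nat \<Rightarrow> real"
  assumes "0 < q" "0 < k" and v: "\<And>j b. j < k \<Longrightarrow> b < q \<Longrightarrow> (\<Sum>i<d. (v j b i)\<^sup>2) = 1"
  obtains c :: "nat \<Rightarrow> real" where
    "3/4 * real q ^ k \<le> card {f\<in>PiE {..<k} (\<lambda>_. {..<q}).
      (\<Sum>i<d. ((\<Sum>j<k. v j (f j) i) - c i)\<^sup>2) \<le> 4 * real k}"
proof -
  define \<mu> where "\<mu> j i = (\<Sum>b<q. v j b i) / q" for j i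
  let ?P = "PiE {..<k} (\<lambda>_. {..<q})"
  have q: "real q > 0" using assms(1) by simp
  have dev: "(\<Sum>b<q. (v j b i - \<mu> j i)\<^sup>2) \<le> (\<Sum>b<q. (v j b i)\<^sup>2)" for j i
  proof -
    have "(\<Sum>b<q. v j b i) = q * \<mu> j i"
      using q by (simp add: \<mu>_def)
    moreover have "(\<Sum>b<q. (v j b i - \<mu> j i)\<^sup>2) =
        (\<Sum>b<q. (v j b i)\<^sup>2) + q * (\<mu> j i)\<^sup>2 - 2 * \<mu> j i * (\<Sum>b<q. v j b i)"
      by (simp add: power2_diff sum.distrib sum_subtractf sum_distrib_left mult_ac)
    ultimately have "(\<Sum>b<q. (v j b i - \<mu> j i)\<^sup>2) = (\<Sum>b<q. (v j b i)\<^sup>2) - q * (\<mu> j i)\<^sup>2"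
      by (simp add: power2_eq_square)
    then show ?thesis using q by simp
  qed
  have zero: "(\<Sum>b<q. v j b i - \<mu> j i) = 0" for i j
    using q by (simp add: \<mu>_def sum_subtractf)
  have "q * (\<Sum>f\<in>?P. \<Sum>i<d. ((\<Sum>j<k. v j (f j) i) - (\<Sum>j<k. \<mu> j i))\<^sup>2) =
      (\<Sum>i<d. q * (\<Sum>f\<in>?P. (\<Sum>j<k. v j (f j) i - \<mu> j i)\<^sup>2))"
    by (subst sum.swap) (simp add: sum_distrib_left sum_subtractf)
  also have "\<dots> = (\<Sum>i<d. real q ^ k * (\<Sum>j<k. \<Sum>b<q. (v j b i - \<mu> j i)\<^sup>2))"
    using sum_PiE_square_sum[of "{..<k}" "{..<q}" "\<lambda>j b. v j b i - \<mu> j i" for i] zero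
    by (intro sum.cong) auto
  also have "\<dots> \<le> (\<Sum>i<d. real q ^ k * (\<Sum>j<k. \<Sum>b<q. (v j b i)\<^sup>2))"
    by (rule sum_mono, rule mult_left_mono, rule sum_mono, rule dev) auto
  also have "\<dots> = real q ^ k * (\<Sum>j<k. \<Sum>i<d. \<Sum>b<q. (v j b i)\<^sup>2)"
    by (subst sum.swap) (simp add: sum_distrib_left)
  also have "(\<Sum>j<k. \<Sum>i<d. \<Sum>b<q. (v j b i)\<^sup>2) = (\<Sum>j<k. \<Sum>b<q. 1)"
    by (subst sum.swap) (use v in \<open>auto intro!: sum.cong\<close>)
  also have "\<dots> = real q * k"
    by simp
  finally have "(\<Sum>f\<in>?P. \<Sum>i<d. ((\<Sum>j<k. v j (f j) i) - (\<Sum>j<k. \<mu> j i))\<^sup>2) \<le> card ?P * real k"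
    using q by (simp add: card_PiE mult_ac)
  then show ?thesis
    using that[of "\<lambda>i. \<Sum>j<k. \<mu> j i"] assms(2)
      card_le_four_times_mean_ge[of ?P "\<lambda>f. \<Sum>i<d. ((\<Sum>j<k. v j (f j) i) - (\<Sum>j<k. \<mu> j i))\<^sup>2" "real k"]
    by (simp add: card_PiE finite_PiE sum_nonneg)
qed

section \<open>Packing bound for separated word sums\<close>

lemma dimension_bound_of_separated_sums:
  fixes v :: "nat \<Rightarrow> nat \<Rightarrow> nat \<Rightarrow> real" and m :: real
  assumes "3 \<le> q" "0 < k" "0 < d" "0 < m"
    and v: "\<And>j b. j < k \<Longrightarrow> b < q \<Longrightarrow> (\<Sum>i<d. (v j b i)\<^sup>2) = 1"
    and sep: "\<And>f g. f \<in> PiE {..<k} (\<lambda>_. {..<q}) \<Longrightarrow> g \<in> PiE {..<k} (\<lambda>_. {..<q}) \<Longrightarrow>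
      2 * m * hamming k f g \<le> L2_set (\<lambda>i. (\<Sum>j<k. v j (f j) i) - (\<Sum>j<k. v j (g j) i)) {..<d}"
  shows "real k * ln (real q) \<le> 292 * real d * ln (1 + 2 / (m * sqrt k))"
proof -
  let ?P = "PiE {..<k} (\<lambda>_. {..<q})"
  obtain c where c: "3/4 * real q ^ k \<le>
      card {f\<in>?P. (\<Sum>i<d. ((\<Sum>j<k. v j (f j) i) - c i)\<^sup>2) \<le> 4 * real k}"
    using obtains_center_of_word_sums[of q k v d] assms(1,2) v by auto
  define X where "X f i = (\<Sum>j<k. v j (f j) i) - c i" for f i
  define W where "W = {f\<in>?P. (\<Sum>i<d. (X f i)\<^sup>2) \<le> 4 * real k}"
  define M where "M = (5/4) ^ k * (4 * real q) powr (k / 12)"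
  \<comment> \<open>Up to a constant, \<open>t\<close> compares the ball with a cell: radius
    \<open>2 * sqrt k\<close> over diameter \<open>m * k / 6\<close> is
    \<open>6 * t\<close>.\<close>
  define t where "t = 2 / (m * sqrt k)"
  have finP: "finite ?P" by (intro finite_PiE) auto
  have X_diff: "X f i - X g i = (\<Sum>j<k. v j (f j) i) - (\<Sum>j<k. v j (g j) i)" for f g i
    by (simp add: X_def)
  have W: "3/4 * real q ^ k \<le> card W"
    using c by (simp add: W_def X_def)
  have numeric: "real q powr (k / 4) * M \<le> card W"
    using powr_mult_hamming_ball_bound_le[of "real q" k] assms(1,2) W by (simp add: M_def)
  \<comment> \<open>Separation turns diameter \<open>m * k / 6\<close> into Hamming distance at most
    \<open>k / 12\<close> from any chosen member. This is used twice: for \<open>W\<close> itself,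
    to bound \<open>t\<close> from below, and for one cell of the cover.\<close>
  have fibre: "real (card A) \<le> M"
    if A: "A \<subseteq> W" and r: "\<And>f g. f \<in> A \<Longrightarrow> g \<in> A \<Longrightarrow>
      L2_set (\<lambda>i. X f i - X g i) {..<d} \<le> m * k / 6" for A
  proof (cases "A = {}")
    case True
    then show ?thesis using assms(1) by (simp add: M_def)
  next
    case False
    then obtain g where g: "g \<in> A" by blast
    have P: "f \<in> ?P" if "f \<in> A" for f
      using that A by (auto simp: W_def)
    show ?thesis unfolding M_def
    proof (rule card_hamming_ball_le)
      show "A \<subseteq> ?P" "g \<in> ?P" using P g by blast+
      fix f assume f: "f \<in> A"
      have "2 * m * hamming k f g \<le> m * k / 6"
        using sep[OF P[OF f] P[OF g]] r[OF f g] unfolding X_diff by linarith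
      then have "m * hamming k f g \<le> m * (k / 12)" by simp
      then show "real (hamming k f g) \<le> k / 12"
        using assms(4) by (simp only: mult_le_cancel_left_pos)
    qed (use assms in auto)
  qed
  have R: "L2_set (X f) {..<d} \<le> 2 * sqrt k" if "f \<in> W" for f
  proof -
    have "L2_set (X f) {..<d} \<le> sqrt (4 * real k)"
      using that by (simp add: W_def L2_set_def)
    then show ?thesis by (simp add: real_sqrt_mult)
  qed
  have kk: "real k = sqrt k * sqrt k" "0 < sqrt k" using assms(2) by simp_all
  have "0 < M" using assms(1) by (simp add: M_def)
  \<comment> \<open>Otherwise all of \<open>W\<close> would lie in a single Hamming ball of radius \<open>k/12\<close>.\<close>
  have t: "1/12 < t"
  proof (rule ccontr)
    assume "\<not> 1/12 < t"
    then have "24 \<le> m * sqrt k"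
      using assms(2,4) by (simp add: t_def field_simps)
    then have "24 * sqrt k \<le> m * sqrt k * sqrt k"
      by (intro mult_right_mono) auto
    then have mk: "4 * sqrt k \<le> m * k / 6"
      using kk by (simp add: mult.assoc)
    \<comment> \<open>Two points of \<open>W\<close> are at most \<open>4 * sqrt k\<close> apart,
      being within \<open>2 * sqrt k\<close> of the centre.\<close>
    have "real (card W) \<le> M"
    proof (rule fibre)
      fix f g assume fg: "f \<in> W" "g \<in> W"
      have "L2_set (\<lambda>i. X f i + - X g i) {..<d} \<le>
          L2_set (X f) {..<d} + L2_set (\<lambda>i. - X g i) {..<d}"
        by (rule L2_set_triangle_ineq)
      also have "L2_set (\<lambda>i. - X g i) {..<d} = L2_set (X g) {..<d}"
        by (simp add: L2_set_def)
      finally show "L2_set (\<lambda>i. X f i - X g i) {..<d} \<le> m * k / 6"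
        using R[OF fg(1)] R[OF fg(2)] mk by simp
    qed simp
    moreover have "1 < real q powr (k / 4)"
      using assms(1,2) by simp
    ultimately have "card W < real q powr (k / 4) * M"
      using \<open>0 < M\<close> by (simp add: le_less_trans)
    then show False
      using numeric by simp
  qed
  obtain A where A: "A \<subseteq> W"
      "\<And>f g. f \<in> A \<Longrightarrow> g \<in> A \<Longrightarrow> L2_set (\<lambda>i. X f i - X g i) {..<d} \<le> m * k / 6"
      "real (card W) \<le> (3 * (2 * (2 * sqrt k / (m * k / 6) + 1) + 1)) ^ d * card A"
  proof (rule obtains_large_subset_of_diameter_le[of W d "2 * sqrt k" "m * k / 6" X])
    show "finite W" using finP by (simp add: W_def)
  qed (use assms(2-4) in \<open>simp_all add: R\<close>)
  note numeric
  also note A(3)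
  also have "2 * sqrt k / (m * k / 6) = 6 * t"
    using kk assms(4) unfolding t_def by (subst kk(1)) (simp add: field_simps)
  also have "3 * (2 * (6 * t + 1) + 1) = 9 + 36 * t"
    by simp
  also have "(9 + 36 * t) ^ d * card A \<le> (9 + 36 * t) ^ d * M"
    using t fibre[OF A(1,2)] by (intro mult_left_mono) auto
  finally have "real q powr (k / 4) * M \<le> (9 + 36 * t) ^ d * M" .
  then have "real q powr (k / 4) \<le> (9 + 36 * t) ^ d"
    using \<open>0 < M\<close> by simp
  \<comment> \<open>The lower bound on \<open>t\<close> absorbs the constants: Bernoulli gives
    \<open>(1 + t) ^ 12 \<ge> 2\<close>, so 72 factors yield 64 and one more supplies the growth in
    \<open>t\<close>. The exponent \<open>k / 4\<close> then leads to 292 = 4 * 73.\<close>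
  also have "\<dots> \<le> ((1 + t) ^ 73) ^ d"
  proof (rule power_mono)
    have "2 \<le> (1 + t) ^ 12"
      using Bernoulli_inequality[of t 12] t by simp
    then have "2 ^ 6 \<le> ((1 + t) ^ 12) ^ 6"
      by (intro power_mono) auto
    then have "64 \<le> (1 + t) ^ 72"
      by (simp flip: power_mult)
    have "9 + 36 * t \<le> 64 * (1 + t)"
      using t by simp
    also have "\<dots> \<le> (1 + t) ^ 72 * (1 + t)"
      using t \<open>64 \<le> (1 + t) ^ 72\<close> by (intro mult_right_mono) auto
    also have "\<dots> = (1 + t) ^ 73"
      by (simp flip: power_Suc2)
    finally show "9 + 36 * t \<le> (1 + t) ^ 73" .
  qed (use t in auto)
  finally have "ln (real q powr (k / 4)) \<le> ln (((1 + t) ^ 73) ^ d)"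
    using assms(1) t by (subst ln_le_cancel_iff) auto
  then have "real k / 4 * ln (real q) \<le> real d * (73 * ln (1 + t))"
    using assms(1) t by (simp add: ln_powr ln_realpow)
  then show ?thesis by (simp add: t_def)
qed

section \<open>From embeddings to separated words\<close>

text \<open>Testing the difference against \<open>u\<close> gains at least \<open>m\<close> for each element of the
  symmetric difference.\<close>

lemma L2_set_diff_ge_margin:
  fixes u :: "nat \<Rightarrow> real" and v :: "'a \<Rightarrow> nat \<Rightarrow> real"
  assumes fin: "finite S" "finite T" and u: "(\<Sum>i<d. (u i)\<^sup>2) = 1"
    and pos: "\<And>x. x \<in> S \<Longrightarrow> m \<le> inner_d d u (v x)"
    and neg: "\<And>x. x \<in> T - S \<Longrightarrow> inner_d d u (v x) \<le> - m"
  shows "m * (card (S - T) + card (T - S)) \<le> L2_set (\<lambda>i. (\<Sum>x\<in>S. v x i) - (\<Sum>x\<in>T. v x i)) {..<d}"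
proof -
  let ?w = "\<lambda>i. (\<Sum>x\<in>S. v x i) - (\<Sum>x\<in>T. v x i)"
  have split: "(\<Sum>x\<in>S. h x) - (\<Sum>x\<in>T. h x) = (\<Sum>x\<in>S - T. h x) - (\<Sum>x\<in>T - S. h x)" for h :: "'a \<Rightarrow> real"
    using sum.Int_Diff[OF fin(1), of h T] sum.Int_Diff[OF fin(2), of h S] by (simp add: Int_commute)
  have "m * (card (S - T) + card (T - S)) = (\<Sum>x\<in>S - T. m) - (\<Sum>x\<in>T - S. - m)"
    by (simp add: algebra_simps)
  also have "\<dots> \<le> (\<Sum>x\<in>S - T. inner_d d u (v x)) - (\<Sum>x\<in>T - S. inner_d d u (v x))"
    using pos neg by (intro diff_mono sum_mono) auto
  also have "\<dots> = inner_d d u ?w"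
    unfolding split[symmetric] inner_d_def
    by (simp add: right_diff_distrib sum_subtractf sum_distrib_left sum.swap[of _ "{..<d}"])
  also have "\<dots> \<le> (\<Sum>i<d. \<bar>u i\<bar> * \<bar>?w i\<bar>)"
    unfolding inner_d_def by (intro sum_mono) (simp flip: abs_mult)
  also have "\<dots> \<le> L2_set u {..<d} * L2_set ?w {..<d}"
    by (rule L2_set_mult_ineq)
  finally show ?thesis
    using u by (simp add: L2_set_def)
qed

text \<open>Replaces the supremum by a margin that is actually realised, so that attainment never
  has to be shown.\<close>

lemma less_m_rdE:
  assumes "0 \<le> y" "ereal y < m_rd d R n A"
  obtains m where "y < m" "rd_embedding d R n A m"
proof -
  have "ereal y < Sup (ereal ` {m. m \<ge> 0 \<and> rd_embedding d R n A m})"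
    using assms(2) by (auto simp: m_rd_def split: if_splits)
  then show ?thesis
    using that by (auto simp: less_Sup_iff)
qed

text \<open>Column \<open>j * q + b\<close> is letter \<open>b\<close> of block \<open>j\<close>, so
  a word \<open>f\<close> becomes a \<open>k\<close>-set \<open>T f\<close>, which is a row of the
  matrix. Both \<open>T f - T g\<close> and \<open>T g - T f\<close> have the Hamming distance as
  size, hence the factor 2 when the row vector of \<open>T f\<close> is the test vector.\<close>

lemma rd_embedding_separated_word_sums:
  assumes emb: "rd_embedding d (S_rows n k) n S_entry m" and kq: "k * q \<le> n"
  obtains v where "\<And>j b. j < k \<Longrightarrow> b < q \<Longrightarrow> (\<Sum>i<d. (v j b i)\<^sup>2) = 1"
    "\<And>f g. f \<in> PiE {..<k} (\<lambda>_. {..<q}) \<Longrightarrow> g \<in> PiE {..<k} (\<lambda>_. {..<q}) \<Longrightarrow>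
      2 * m * hamming k f g \<le> L2_set (\<lambda>i. (\<Sum>j<k. v j (f j) i) - (\<Sum>j<k. v j (g j) i)) {..<d}"
proof -
  let ?P = "PiE {..<k} (\<lambda>_. {..<q})"
  from emb obtain U V where
    U: "\<forall>T\<in>S_rows n k. unit_vec d (U T)" and V: "\<forall>i<n. unit_vec d (V i)"
    and UV: "\<forall>T\<in>S_rows n k. \<forall>i<n. (i \<in> T \<longrightarrow> m \<le> inner_d d (U T) (V i)) \<and>
      (i \<notin> T \<longrightarrow> inner_d d (U T) (V i) \<le> - m)"
    unfolding rd_embedding_def S_entry_def by auto
  have idx: "j * q + b < n" if "j < k" "b < q" for j b
  proof -
    have "j * q + b < Suc j * q" using that by simp
    also have "\<dots> \<le> k * q" using that by (intro mult_le_mono1) auto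
    also note kq
    finally show ?thesis .
  qed
  define T where "T f = (\<lambda>j. j * q + f j) ` {..<k}" for f
  have code_eq: "j = j' \<and> b = b'" if "j * q + b = j' * q + b'" "b < q" "b' < q" for j j' b b'
  proof -
    have "(i * q + c) div q = i" "(i * q + c) mod q = c" if "c < q" for i c
      using that by auto
    with that show ?thesis by metis
  qed
  have inj: "inj_on (\<lambda>j. j * q + f j) {..<k}" if "f \<in> ?P" for f
    using that by (intro inj_onI) (auto dest!: code_eq simp: PiE_iff)
  have T: "T f \<in> S_rows n k" if "f \<in> ?P" for f
    using that idx inj[OF that] by (auto simp: S_rows_def T_def card_image PiE_iff)
  have T_diff: "card (T f - T g) = hamming k f g" if fg: "f \<in> ?P" "g \<in> ?P" for f g
  proof -
    have "T f - T g = (\<lambda>j. j * q + f j) ` {j. j < k \<and> f j \<noteq> g j}"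
      using fg by (auto simp: T_def PiE_iff dest: code_eq)
    moreover have "inj_on (\<lambda>j. j * q + f j) {j. j < k \<and> f j \<noteq> g j}"
      using inj[OF fg(1)] by (rule inj_on_subset) auto
    ultimately show ?thesis by (simp add: card_image hamming_def)
  qed
  have sums: "(\<Sum>x\<in>T f. V x i) = (\<Sum>j<k. V (j * q + f j) i)" if "f \<in> ?P" for f i
    unfolding T_def using inj[OF that] by (simp add: sum.reindex)
  show thesis
  proof (rule that[of "\<lambda>j b. V (j * q + b)"])
    fix j b assume "j < k" "b < q"
    then show "(\<Sum>i<d. (V (j * q + b) i)\<^sup>2) = 1"
      using V idx by (simp add: unit_vec_def inner_d_def power2_eq_square)
  next
    fix f g assume fg: "f \<in> ?P" "g \<in> ?P"
    have "m * (card (T f - T g) + card (T g - T f)) \<le>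
        L2_set (\<lambda>i. (\<Sum>x\<in>T f. V x i) - (\<Sum>x\<in>T g. V x i)) {..<d}"
    proof (rule L2_set_diff_ge_margin)
      have lt: "x < n" if "x \<in> T f \<or> x \<in> T g" for x
        using that T[OF fg(1)] T[OF fg(2)] by (auto simp: S_rows_def)
      show "(\<Sum>i<d. (U (T f) i)\<^sup>2) = 1"
        using U T[OF fg(1)] by (simp add: unit_vec_def inner_d_def power2_eq_square)
      show "m \<le> inner_d d (U (T f)) (V x)" if "x \<in> T f" for x
        using UV T[OF fg(1)] that lt by blast
      show "inner_d d (U (T f)) (V x) \<le> - m" if "x \<in> T g - T f" for x
        using UV T[OF fg(1)] that lt by blast
    qed (auto simp: T_def)
    moreover have "hamming k g f = hamming k f g"
      by (simp add: hamming_def eq_commute)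
    ultimately show "2 * m * hamming k f g \<le>
        L2_set (\<lambda>i. (\<Sum>j<k. V (j * q + f j) i) - (\<Sum>j<k. V (j * q + g j) i)) {..<d}"
      using fg by (simp add: T_diff sums algebra_simps)
  qed
qed

section \<open>The dimension bound in terms of \<open>n / k\<close> and the supremum\<close>

lemma rd_embedding_dimension_bound:
  assumes emb: "rd_embedding d (S_rows n k) n S_entry m"
    and "0 < k" "0 < d" "3 * k \<le> n" "0 < m"
  shows "real k * ln (real n / real k) \<le> 584 * real d * ln (1 + 2 / (m * sqrt k))"
proof -
  define q where "q = n div k"
  have q: "3 \<le> q"
    using assms(2,4) by (simp add: q_def less_eq_div_iff_mult_less_eq)
  have "k * q \<le> n"
    by (simp add: q_def)
  with emb obtain v where "\<And>j b. j < k \<Longrightarrow> b < q \<Longrightarrow> (\<Sum>i<d. (v j b i)\<^sup>2) = 1"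
    "\<And>f g. f \<in> PiE {..<k} (\<lambda>_. {..<q}) \<Longrightarrow> g \<in> PiE {..<k} (\<lambda>_. {..<q}) \<Longrightarrow>
      2 * m * hamming k f g \<le> L2_set (\<lambda>i. (\<Sum>j<k. v j (f j) i) - (\<Sum>j<k. v j (g j) i)) {..<d}"
    using rd_embedding_separated_word_sums by blast
  then have "real k * ln (real q) \<le> 292 * real d * ln (1 + 2 / (m * sqrt k))"
    using q assms(2,3,5) by (intro dimension_bound_of_separated_sums)
  \<comment> \<open>Rounding in \<open>n div k\<close> is paid for by squaring:
    \<open>n < (q + 1) * k \<le> q\<^sup>2 * k\<close>. This doubles 292 to 584.\<close>
  moreover have "ln (real n / real k) \<le> 2 * ln (real q)"
  proof -
    have "n < (q + 1) * k"
      using assms(2) unfolding q_def by (metis add.commute div_less_iff_less_mult less_add_one)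
    also have "\<dots> \<le> q\<^sup>2 * k"
    proof (rule mult_le_mono1)
      have "q + 1 \<le> 3 * q" using q by simp
      also have "\<dots> \<le> q * q" using q by (rule mult_le_mono1)
      finally show "q + 1 \<le> q\<^sup>2" by (simp add: power2_eq_square)
    qed
    finally have "real n \<le> real q ^ 2 * real k"
      by (metis less_imp_le of_nat_le_iff of_nat_mult of_nat_power)
    then have "real n / k \<le> real q ^ 2"
      using assms(2) by (simp add: field_simps)
    moreover have "0 < real n / k" using assms(2,4) by simp
    ultimately have "ln (real n / k) \<le> ln (real q ^ 2)"
      by (subst ln_le_cancel_iff) (use q in auto)
    then show ?thesis using q by (simp add: ln_realpow)
  qed
  then have "real k * ln (real n / real k) \<le> real k * (2 * ln (real q))"
    by (intro mult_left_mono) auto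
  ultimately show ?thesis by simp
qed

theorem theorem1p5:
  shows "\<exists>C>0. \<forall>n k d::nat. 0 < n \<longrightarrow> 0 < k \<longrightarrow> 0 < d \<longrightarrow> n \<ge> 3 * k \<longrightarrow>
     m_rd d (S_rows n k) n S_entry > 0 \<longrightarrow>
     real d \<ge> C * (real k * ln (real n / real k)) /
        ln (1 + 2 / (real_of_ereal (m_rd d (S_rows n k) n S_entry) * sqrt (real k)))"
proof (intro exI[of _ "1/1168"] conjI allI impI)
  fix n k d :: nat
  assume *: "0 < n" "0 < k" "0 < d" "3 * k \<le> n" and pos: "0 < m_rd d (S_rows n k) n S_entry"
  show "real d \<ge> 1/1168 * (real k * ln (real n / real k)) /
      ln (1 + 2 / (real_of_ereal (m_rd d (S_rows n k) n S_entry) * sqrt (real k)))"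
  proof (cases "m_rd d (S_rows n k) n S_entry")
    case (real a)
    define t where "t = 2 / (a * sqrt k)"
    have a: "0 < a" using pos real by simp
    then have t: "0 < t" using * by (simp add: t_def)
    \<comment> \<open>Half the supremum is exceeded by a realised margin. The lost factor 2 is
      absorbed by \<open>1 + 2 * t \<le> (1 + t)\<^sup>2\<close>, which doubles the constant to
      1168.\<close>
    obtain m where m: "a / 2 < m" "rd_embedding d (S_rows n k) n S_entry m"
      using less_m_rdE[of "a / 2" d "S_rows n k" n S_entry] a real by auto
    then have "real k * ln (real n / real k) \<le> 584 * real d * ln (1 + 2 / (m * sqrt k))"
      using * a by (intro rd_embedding_dimension_bound) auto
    also have "\<dots> \<le> 584 * real d * ln ((1 + t)\<^sup>2)"
    proof (intro mult_left_mono ln_mono)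
      have "2 / (m * sqrt k) \<le> 2 / (a / 2 * sqrt k)"
        using m(1) a *(2) by (intro divide_left_mono mult_right_mono mult_pos_pos) auto
      also have "\<dots> = 2 * t"
        by (simp add: t_def)
      finally show "1 + 2 / (m * sqrt k) \<le> (1 + t)\<^sup>2"
        by (simp add: power2_sum add_increasing)
      show "0 < 1 + 2 / (m * sqrt k)"
        using m(1) a by (simp add: add_pos_nonneg)
    qed simp
    also have "\<dots> = 1168 * real d * ln (1 + t)"
      using t by (simp add: ln_realpow)
    finally show ?thesis
      using t by (simp add: real t_def[symmetric] divide_le_eq)
  \<comment> \<open>For an infinite supremum \<open>real_of_ereal\<close> gives 0, both divisions by
    zero give 0, and the bound reads \<open>d \<ge> 0\<close>; the value minus infinity contradicts
    \<open>pos\<close>.\<close>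
  qed (use pos in auto)
qed simp

end
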